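(* The generating functional function $\mathscr{P}(y,x;n)$ of the complementary polynomials $\mathscr{P}_\nu(x;n)$ is given in closed form by $$\mathscr{P}(y,x;n)\,\mathbf{u}=\left(\frac{\phi(x+y\phi(x))}{\phi(x)}\right)^n\widetilde{\mathbf{u}},$$ and $$\frac{\partial^\mu}{\partial y^\mu}\mathscr{P}(y,x;n)\,\mathbf{u}=\left(\frac{\phi(x+y\phi(x))}{\phi(x)}\right)^{n-\mu}\mathscr{P}_\mu(x+y\phi(x);n)\,\widetilde{\mathbf{u}},$$ where $\widetilde{\mathbf{u}}=\exp\!\big(y\phi(x)\tfrac{d}{dx}\big)\circ\mathbf{u}$.
   Context: Let $\mathbb{P}$ be the space of polynomials with complex coefficients and $\mathbb{P}'$ its algebraic dual (the linear functionals on $\mathbb{P}$). For $\mathbf{v}\in\mathbb{P}'$ and $Q\in\mathbb{P}$, the functionals $Q\mathbf{v}$ and $\frac{d}{dx}\mathbf{v}=\mathbf{v}'$ are defined by $\langle Q\mathbf{v},P\rangle=\langle\mathbf{v},QP\rangle$ and $\langle\mathbf{v}',P\rangle=-\langle\mathbf{v},P'\rangle$ for $P\in\mathbb{P}$. Setting. $\phi,\psi$ are polynomials with $\deg\phi\le2$, $\deg\psi\le1$, and $\mathbf{u}\in\mathbb{P}'$ satisfies $\frac{d}{dx}[\phi\mathbf{u}]=\psi\mathbf{u}$. For $n=0,1,2,\dots$, $P_n$ denotes the polynomial solution of $\phi P_n''+\psi P_n'+\lambda_nP_n=0$, $\lambda_n=-n\psi'-\frac n2(n-1)\phi''$. These polynomials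 are orthogonal with respect to $\mathbf{u}$: $\langle\mathbf{u},P_nP_m\rangle=r_n\delta_{n,m}$ with $r_n\ne0$. With $\mathbf{u}_0=\mathbf{u}$ and $\mathbf{u}_k=\phi\,\mathbf{u}_{k-1}$ for $k\ge1$, they satisfy the Rodrigues functional formula $P_n\mathbf{u}=B_n\frac{d^n}{dx^n}[\mathbf{u}_n]$ with $B_n\ne0$. Complementary polynomials. For integers $0\le\nu\le n$, the complementary polynomial $\mathscr{P}_\nu(x;n)$, of degree $\nu$, with respect to $P_n$ is defined by $$P_n\,\mathbf{u}=B_n\frac{d^{\,n-\nu}}{dx^{\,n-\nu}}\big[\mathscr{P}_\nu(x;n)\,\mathbf{u}_{n-\nu}\big].$$ These polynomials satisfy $\mathscr{P}_0(x;n)\equiv1$ and $$\mathscr{P}_{\nu+1}(x;n)=\phi(x)\frac{d\mathscr{P}_\nu(x;n)}{dx}+\big(\psi(x)+(n-\nu-1)\phi'(x)\big)\mathscr{P}_\nu(x;n),$$ and this recursion also gives the $\mathscr{P}_\nu(x;n)$ with $\nu>n$ that occur in the series below. Generating functional function. It is $$\mathscr{P}(y,x;n)=\sum_{\nu=0}^{\infty}\frac{y^\nu}{\nu!}\mathscr{P}_\nu(x;n),$$ where the series converges for $|y|<\epsilon$ for some $\epsilon>0$ and can be summed in closed form if the generating functional function is regular at the point $x$ (the corresponding expansion in powers of $y\phi(x)$ converging for $|y\phi(x)|<\epsilon$ for a suitable $\epsilon>0$ when $x$ is such a regular point). Here $\exp\!\big(y\phi(x)\frac{d}{dx}\big)$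 stands for $\sum_{\nu\ge0}\frac{(y\phi(x))^\nu}{\nu!}\frac{d^\nu}{dx^\nu}$, with the powers of $\phi$ to the left of the derivatives, and $\mu$ is a nonnegative integer. *)

theory Defs
  imports "HOL-Analysis.Analysis" "HOL-Computational_Algebra.Computational_Algebra"
begin

section \<open>Functionals on polynomials\<close>

text \<open>Elements of the algebraic dual are functions \<open>v :: complex poly \<Rightarrow> complex\<close> that satisfy
  \<open>Vector_Spaces.linear smult (*) v\<close>. All operations below preserve linearity.\<close>

type_synonym functional = "complex poly \<Rightarrow> complex"

definition fmul :: "complex poly \<Rightarrow> functional \<Rightarrow> functional" (infixr "\<odot>" 75) where
  "Q \<odot> v = (\<lambda>P. v (Q * P))"

definition fscale :: "complex \<Rightarrow> functional \<Rightarrow> functional" where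
  "fscale c v = (\<lambda>P. c * v P)"

definition fderiv :: "functional \<Rightarrow> functional" where
  "fderiv v = (\<lambda>P. - v (pderiv P))"

primrec shifted_functional :: "complex poly \<Rightarrow> functional \<Rightarrow> nat \<Rightarrow> functional" where
  "shifted_functional \<phi> u 0 = u"
| "shifted_functional \<phi> u (Suc k) = \<phi> \<odot> shifted_functional \<phi> u k"

text \<open>Since the degrees of \<open>\<phi>\<close> and \<open>\<psi>\<close> are at most 2 and 1, this is a constant polynomial.\<close>

definition eigenvalue :: "complex poly \<Rightarrow> complex poly \<Rightarrow> nat \<Rightarrow> complex poly" where
  "eigenvalue \<phi> \<psi> n =
     - smult (of_nat n) (pderiv \<psi>)
     - smult (of_nat n / 2 * (of_nat n - 1)) (pderiv (pderiv \<phi>))"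

section \<open>Complementary polynomials\<close>

text \<open>\<open>C \<nu> n\<close> is the complementary polynomial of index \<open>\<nu>\<close> with respect to \<open>P n\<close>. For
  \<open>\<nu> \<le> n\<close> it is characterised by its defining functional relation; beyond \<open>n\<close> the family is
  continued by the recursion.\<close>

definition complementary_polynomials ::
  "complex poly \<Rightarrow> complex poly \<Rightarrow> functional \<Rightarrow> (nat \<Rightarrow> complex poly) \<Rightarrow> (nat \<Rightarrow> complex)
   \<Rightarrow> (nat \<Rightarrow> nat \<Rightarrow> complex poly) \<Rightarrow> bool" where
  "complementary_polynomials \<phi> \<psi> u P B C \<longleftrightarrow>
     (\<forall>n. \<forall>\<nu>\<le>n. degree (C \<nu> n) = \<nu> \<and>
        P n \<odot> u = fscale (B n) ((fderiv ^^ (n - \<nu>)) (C \<nu> n \<odot> shifted_functional \<phi> u (n - \<nu>)))) \<and>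
     (\<forall>n. \<forall>\<nu>\<ge>n. C (Suc \<nu>) n =
        \<phi> * pderiv (C \<nu> n) + (\<psi> + smult (of_nat n - of_nat \<nu> - 1) (pderiv \<phi>)) * C \<nu> n)"

section \<open>Power series in y\<close>

text \<open>The variable of formal power series is \<open>y\<close>. Series with polynomial coefficients (in \<open>x\<close>)
  form the ring \<open>complex poly fps\<close>; a series \<open>\<Sum>\<^sub>k y\<^sup>k F\<^sub>k\<close> of functionals is represented by its
  coefficient sequence \<open>F\<close>.\<close>

definition generating_series :: "(nat \<Rightarrow> nat \<Rightarrow> complex poly) \<Rightarrow> nat \<Rightarrow> complex poly fps" where
  "generating_series C n = Abs_fps (\<lambda>\<nu>. smult (1 / fact \<nu>) (C \<nu> n))"

definition fps_fmul :: "complex poly fps \<Rightarrow> functional \<Rightarrow> nat \<Rightarrow> functional" where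
  "fps_fmul A v = (\<lambda>k. fps_nth A k \<odot> v)"

text \<open>The Cauchy product.\<close>

definition fps_act :: "complex poly fps \<Rightarrow> (nat \<Rightarrow> functional) \<Rightarrow> nat \<Rightarrow> functional" where
  "fps_act A F = (\<lambda>k Q. \<Sum>i\<le>k. (fps_nth A i \<odot> F (k - i)) Q)"

definition exp_functional :: "complex poly \<Rightarrow> functional \<Rightarrow> nat \<Rightarrow> functional" where
  "exp_functional \<phi> u = (\<lambda>\<nu>. smult (1 / fact \<nu>) (\<phi> ^ \<nu>) \<odot> (fderiv ^^ \<nu>) u)"

text \<open>\<open>p(x + y \<phi>(x))\<close> as a power series in \<open>y\<close>.\<close>

definition taylor_shift :: "complex poly \<Rightarrow> complex poly \<Rightarrow> complex poly fps" where
  "taylor_shift \<phi> p =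
     poly (map_poly (\<lambda>c. fps_const [:c:]) p) (fps_const [:0, 1:] + fps_X * fps_const \<phi>)"

text \<open>\<open>\<phi>(x + y \<phi>(x)) / \<phi>(x)\<close> as a power series in \<open>y\<close>; the coefficientwise polynomial divisions
  are exact, see \<open>shift_ratio_exact\<close> below.\<close>

definition shift_ratio :: "complex poly \<Rightarrow> complex poly fps" where
  "shift_ratio \<phi> = Abs_fps (\<lambda>k. fps_nth (taylor_shift \<phi> \<phi>) k div \<phi>)"

text \<open>Its integer powers. The ratio has constant coefficient 1, so it is a unit, with inverse
  \<open>fps_right_inverse (shift_ratio \<phi>) 1\<close>; see \<open>shift_ratio_inverse\<close> below.\<close>

definition shift_ratio_powi :: "complex poly \<Rightarrow> int \<Rightarrow> complex poly fps" where
  "shift_ratio_powi \<phi> k =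
     (if 0 \<le> k then shift_ratio \<phi> ^ nat k
      else fps_right_inverse (shift_ratio \<phi>) 1 ^ nat (- k))"

lemma taylor_shift_pCons:
  "taylor_shift \<phi> (pCons a p) =
     fps_const [:a:] + (fps_const [:0, 1:] + fps_X * fps_const \<phi>) * taylor_shift \<phi> p"
  by (cases "pCons a p = 0") (auto simp: taylor_shift_def map_poly_pCons)

lemma taylor_shift_nth_0: "fps_nth (taylor_shift \<phi> p) 0 = p"
  by (induction p) (auto simp: taylor_shift_pCons, simp add: taylor_shift_def)

lemma taylor_shift_nth_dvd: "0 < k \<Longrightarrow> \<phi> dvd fps_nth (taylor_shift \<phi> p) k"
proof (induction p arbitrary: k)
  case 0
  then show ?case by (simp add: taylor_shift_def)
next
  case (pCons a p)
  then have "\<phi> dvd fps_nth (taylor_shift \<phi> p) k" by blast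
  then have "\<phi> dvd [:0, 1:] * fps_nth (taylor_shift \<phi> p) k" by (rule dvd_mult)
  then show ?case using pCons.prems
    by (auto simp: taylor_shift_pCons distrib_right mult.assoc intro!: dvd_add)
qed

lemma shift_ratio_exact: "fps_const \<phi> * shift_ratio \<phi> = taylor_shift \<phi> \<phi>"
proof (rule fps_ext)
  fix k
  have "\<phi> dvd fps_nth (taylor_shift \<phi> \<phi>) k"
    by (cases "k = 0") (simp_all add: taylor_shift_nth_0 taylor_shift_nth_dvd)
  then show "fps_nth (fps_const \<phi> * shift_ratio \<phi>) k = fps_nth (taylor_shift \<phi> \<phi>) k"
    by (simp add: shift_ratio_def)
qed

lemma shift_ratio_inverse:
  assumes "\<phi> \<noteq> 0"
  shows "shift_ratio \<phi> * fps_right_inverse (shift_ratio \<phi>) 1 = 1"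
  by (rule fps_right_inverse) (simp add: shift_ratio_def taylor_shift_nth_0 assms)

section \<open>Evaluation at a complex number y\<close>

text \<open>Convergence of a series of functionals is meant weakly, that is, after pairing it with an
  arbitrary polynomial \<open>Q\<close>.\<close>

definition pairing :: "(nat \<Rightarrow> functional) \<Rightarrow> complex poly \<Rightarrow> complex fps" where
  "pairing F Q = Abs_fps (\<lambda>k. F k Q)"

definition weakly_convergent :: "real \<Rightarrow> (nat \<Rightarrow> functional) \<Rightarrow> bool" where
  "weakly_convergent \<epsilon> F \<longleftrightarrow> (\<forall>Q. ereal \<epsilon> \<le> fps_conv_radius (pairing F Q))"

definition eval_at :: "(nat \<Rightarrow> functional) \<Rightarrow> complex \<Rightarrow> functional" where
  "eval_at F y = (\<lambda>Q. eval_fps (pairing F Q) y)"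

definition taylor_shift_at :: "complex poly \<Rightarrow> complex \<Rightarrow> complex poly \<Rightarrow> complex poly" where
  "taylor_shift_at \<phi> y p = p \<circ>\<^sub>p ([:0, 1:] + smult y \<phi>)"

text \<open>The division is again exact.\<close>

definition shift_ratio_at :: "complex poly \<Rightarrow> complex \<Rightarrow> complex poly" where
  "shift_ratio_at \<phi> y = taylor_shift_at \<phi> y \<phi> div \<phi>"

lemma shift_ratio_at_exact: "\<phi> * shift_ratio_at \<phi> y = taylor_shift_at \<phi> y \<phi>"
proof -
  have "\<phi> dvd taylor_shift_at \<phi> y p - p" for p
  proof (induction p)
    case 0
    then show ?case by (simp add: taylor_shift_at_def)
  next
    case (pCons a p)
    have "taylor_shift_at \<phi> y (pCons a p) - pCons a p =
        [:0, 1:] * (taylor_shift_at \<phi> y p - p) + \<phi> * smult y (taylor_shift_at \<phi> y p)"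
      by (simp add: taylor_shift_at_def pcompose_pCons algebra_simps)
    then show ?case using pCons.IH by (metis dvd_add dvd_mult dvd_triv_left)
  qed
  from dvd_add[OF this[of \<phi>] dvd_refl] have "\<phi> dvd taylor_shift_at \<phi> y \<phi>" by simp
  then show ?thesis by (simp add: shift_ratio_at_def)
qed

end

theory Submission
  imports Defs
begin

text \<open>The orthogonality relations make \<open>\<^bold>u\<close> regular: a polynomial \<open>q\<close> with \<open>q\<^bold>u = 0\<close> is zero
(\<open>regular_functional\<close>). Hence identities between functionals of the form \<open>q\<^bold>u\<close> are identities
between polynomials. Since the derivative is injective on functionals, the defining relations of
\<open>\<P>\<^sub>\<nu>(x;n)\<close> and \<open>\<P>\<^sub>\<nu>\<^sub>+\<^sub>1(x;n)\<close> can be compared after removing the common derivatives, which gives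
the raising recursion for all \<open>\<nu>\<close> (\<open>complementary_raising\<close>). On the other side, the Pearson equation
shows that \<open>\<phi>\<^sup>\<nu>\<^bold>u\<^sup>(\<^sup>\<nu>\<^sup>) = e\<^sub>\<nu>\<^bold>u\<close>, where the \<open>e\<^sub>\<nu>\<close> satisfy the same recursion with parameter 0 in place of
\<open>n\<close> (\<open>exp_functional_raising\<close>); so they are the \<open>\<P>\<^sub>\<nu>(x;0)\<close>, and the functional
\<open>exp(y\<phi> d/dx) \<circ> \<^bold>u\<close> is just \<open>\<P>(y,x;0)\<^bold>u\<close>.

It remains to compare \<open>\<P>(y,x;n)\<close> with \<open>\<P>(y,x;0)\<close> in the ring of power series in \<open>y\<close> over the
polynomials in \<open>x\<close>. Let \<open>L = (1 + y\<phi>')\<partial>\<^sub>y - \<phi>\<partial>\<^sub>x\<close>. This derivation annihilates every function of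
\<open>x + y\<phi>(x)\<close>, hence multiplies \<open>S = \<phi>(x + y\<phi>(x)) / \<phi>(x)\<close> by \<open>\<phi>'\<close>, and the raising recursion with
parameter \<open>s\<close> says exactly that \<open>L\<close> multiplies the exponential generating series by
\<open>\<psi> + (s - 1)\<phi>'\<close>. Therefore \<open>\<partial>\<^sub>y\<^sup>\<mu> \<P>(y,x;n)\<close> and \<open>S\<^sup>n\<^sup>-\<^sup>\<mu> \<P>\<^sub>\<mu>(x + y\<phi>(x);n) \<P>(y,x;0)\<close> satisfy the same first-order
equation with the same value at \<open>y = 0\<close>, and they coincide (\<open>raising_closed_form\<close>). The first formula
is the case \<open>\<mu> = 0\<close>.

For convergence, pairing the coefficient of \<open>y\<^sup>k\<close> in \<open>exp(y\<phi> d/dx) \<circ> \<^bold>u\<close> with \<open>q\<close> gives, up to sign,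
\<open>\<^bold>u\<close> applied to \<open>(\<phi>\<^sup>kq)\<^sup>(\<^sup>k\<^sup>)/k!\<close>. A weighted sum of the moduli of the coefficients of this polynomial
grows at most geometrically. If \<open>\<phi>\<close> has degree 2, so do the moments of \<open>\<^bold>u\<close>, by the three-term
recursion that the Pearson equation imposes on them; if \<open>\<phi>\<close> has smaller degree, the moments may grow
faster, but then the degree of the polynomial does not exceed that of \<open>q\<close>, so only finitely many moments
enter. Either way the radius of convergence is bounded below independently of \<open>q\<close>
(\<open>exp_functional_weakly_convergent\<close>). The series \<open>\<P>(y,x;n)\<^bold>u\<close> inherits this bound because \<open>S\<close> is a
polynomial in \<open>y\<close> (\<open>fps_act_polynomial\<close>), and its derivatives inherit it because differentiation does
not decrease the radius; this covers \<open>\<mu> > n\<close>, where negative powers of \<open>S\<close> occur. For \<open>\<mu> \<le> n\<close> the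
factor \<open>S\<^sup>n\<^sup>-\<^sup>\<mu> \<P>\<^sub>\<mu>(x + y\<phi>(x);n)\<close> is itself a polynomial in \<open>y\<close>, so that a number can be inserted for
\<open>y\<close> in each factor separately.\<close>

section \<open>Functionals and their derivatives\<close>

abbreviation functional_linear :: "functional \<Rightarrow> bool" where
  "functional_linear v \<equiv> Vector_Spaces.linear smult (*) v"

lemma functional_linear_rules:
  assumes "functional_linear v"
  shows functional_add: "v (p + q) = v p + v q"
    and functional_smult: "v (smult c p) = c * v p"
    and functional_0: "v 0 = 0"
    and functional_diff: "v (p - q) = v p - v q"
    and functional_sum: "v (sum f A) = (\<Sum>i\<in>A. v (f i))"
proof -
  interpret module_hom smult "(*)" v
    using assms by (simp add: Vector_Spaces.linear_iff_module_hom)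
  show "v (p + q) = v p + v q" by (rule add)
  show "v (smult c p) = c * v p" by (rule scale)
  show "v 0 = 0" by (rule zero)
  show "v (p - q) = v p - v q" by (rule diff)
  show "v (sum f A) = (\<Sum>i\<in>A. v (f i))" by (rule sum)
qed

lemma fmul_fmul: "p \<odot> q \<odot> v = (p * q) \<odot> v"
  by (simp add: fmul_def fun_eq_iff mult.assoc mult.left_commute)

lemma shifted_functional_eq: "shifted_functional \<phi> u k = \<phi> ^ k \<odot> u"
  by (induction k) (simp_all add: fmul_fmul, simp add: fmul_def)

lemma pderiv_surj: "\<exists>q. pderiv q = p" for p :: "complex poly"
proof (intro exI poly_eqI)
  fix k
  let ?q = "Abs_poly (\<lambda>i. if i = 0 then 0 else coeff p (i - 1) / of_nat i)"
  have "coeff ?q = (\<lambda>i. if i = 0 then 0 else coeff p (i - 1) / of_nat i)"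
    by (rule coeff_Abs_poly[where n = "Suc (degree p)"]) (auto simp: coeff_eq_0)
  then show "coeff (pderiv ?q) k = coeff p k"
    by (simp add: coeff_pderiv divide_simps del: of_nat_Suc)
qed

text \<open>Dual to the surjectivity of the derivative on polynomials in characteristic 0. This is what allows
derivatives to be cancelled in the relations that define the complementary polynomials.\<close>

lemma inj_fderiv: "inj fderiv"
proof (rule injI, rule ext)
  fix v w :: functional and p :: "complex poly"
  assume eq: "fderiv v = fderiv w"
  obtain q where "pderiv q = p" using pderiv_surj[of p] by blast
  then show "v p = w p" using fun_cong[OF eq, of q] by (simp add: fderiv_def)
qed

lemma fderiv_pow_apply: "(fderiv ^^ k) v p = (- 1) ^ k * v ((pderiv ^^ k) p)"
proof (induction k arbitrary: p)
  case (Suc k)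
  have "(fderiv ^^ Suc k) v p = - (fderiv ^^ k) v (pderiv p)" by (simp add: fderiv_def)
  also have "\<dots> = (- 1) ^ Suc k * v ((pderiv ^^ Suc k) p)" by (simp add: Suc.IH funpow_swap1)
  finally show ?case .
qed simp

section \<open>Regularity and the raising recursion\<close>

text \<open>The \<open>P k\<close> have exact degree \<open>k\<close>, so subtracting a multiple of \<open>P (degree q)\<close> lowers the degree
of \<open>q\<close> without changing the value of \<open>u (q * P d)\<close>.\<close>

lemma orthogonal_lower_degree:
  assumes lin: "functional_linear u"
    and deg_P: "\<And>k. degree (P k) = k"
    and orthogonal: "\<And>k m. u (P k * P m) = (if k = m then r k else 0)"
    and r_nonzero: "\<And>k. r k \<noteq> 0"
    and "degree q < d"
  shows "u (q * P d) = 0"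
  using \<open>degree q < d\<close>
proof (induction "degree q" arbitrary: q rule: less_induct)
  case less
  have Pnz: "P k \<noteq> 0" for k
    using orthogonal[of k k] r_nonzero[of k] functional_0[OF lin] by auto
  define j where "j = degree q"
  define c where "c = lead_coeff q / lead_coeff (P j)"
  define s where "s = q - smult c (P j)"
  have lc: "coeff (P j) j \<noteq> 0" using Pnz[of j] deg_P[of j] by (metis leading_coeff_0_iff)
  have cj: "coeff s j = 0" using lc by (simp add: s_def c_def deg_P j_def[symmetric])
  have "degree s \<le> j" unfolding s_def by (intro degree_diff_le) (auto simp: j_def deg_P)
  have "u (s * P d) = 0"
  proof (cases "s = 0")
    case False
    then have "degree s \<noteq> j" using cj by (metis leading_coeff_0_iff)
    with \<open>degree s \<le> j\<close> show ?thesis using less by (simp add: j_def)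
  qed (simp add: functional_0[OF lin])
  moreover have "q * P d = s * P d + smult c (P j * P d)" by (simp add: s_def algebra_simps)
  moreover have "j \<noteq> d" using less.prems by (simp add: j_def)
  ultimately show ?case by (simp add: functional_linear_rules[OF lin] orthogonal)
qed

text \<open>If the difference \<open>s = p - q\<close> were nonzero of degree \<open>d\<close>, then \<open>P d\<close> would be a multiple of \<open>s\<close>
plus terms of lower degree, and \<open>s \<odot> u = 0\<close> would force \<open>u (P d * P d) = 0\<close>.\<close>

lemma regular_functional:
  assumes lin: "functional_linear u"
    and deg_P: "\<And>k. degree (P k) = k"
    and orthogonal: "\<And>k m. u (P k * P m) = (if k = m then r k else 0)"
    and r_nonzero: "\<And>k. r k \<noteq> 0"
    and eq: "p \<odot> u = q \<odot> u"
  shows "p = q"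
proof (rule ccontr)
  assume "p \<noteq> q"
  define s where "s = p - q"
  have "s \<noteq> 0" using \<open>p \<noteq> q\<close> by (simp add: s_def)
  have s: "u (s * t) = 0" for t
    using fun_cong[OF eq, of t]
    by (simp add: s_def fmul_def left_diff_distrib functional_diff[OF lin])
  define d where "d = degree s"
  define c where "c = lead_coeff (P d) / lead_coeff s"
  have "lead_coeff s \<noteq> 0" using \<open>s \<noteq> 0\<close> by simp
  have Pnz: "P d \<noteq> 0"
    using orthogonal[of d d] r_nonzero[of d] functional_0[OF lin] by auto
  define t where "t = P d - smult c s"
  have "coeff t d = 0" using \<open>lead_coeff s \<noteq> 0\<close>
    by (simp add: t_def c_def deg_P d_def[symmetric])
  moreover have "degree t \<le> d" unfolding t_def by (intro degree_diff_le) (auto simp: d_def deg_P)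
  ultimately have "t = 0 \<or> degree t < d"
    by (metis leading_coeff_0_iff le_neq_implies_less)
  then have "u (t * P d) = 0"
    using orthogonal_lower_degree[OF lin deg_P orthogonal r_nonzero] functional_0[OF lin] by auto
  moreover have "P d * P d = t * P d + smult c (s * P d)" by (simp add: t_def algebra_simps)
  ultimately have "u (P d * P d) = 0" by (simp add: functional_linear_rules[OF lin] s)
  then show False using orthogonal[of d d] r_nonzero[of d] by simp
qed

text \<open>The product rule with the Pearson equation substituted: differentiating a multiple of
\<open>\<phi> \<odot> u\<close> gives again a polynomial multiple of \<open>u\<close>.\<close>

lemma pearson_fderiv:
  assumes lin: "functional_linear u" and pearson: "fderiv (\<phi> \<odot> u) = \<psi> \<odot> u"
  shows "fderiv ((q * \<phi>) \<odot> u) = (\<phi> * pderiv q + \<psi> * q) \<odot> u"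
proof
  fix p
  have "fderiv (\<phi> \<odot> u) (q * p) = (\<psi> \<odot> u) (q * p)" by (simp add: pearson)
  then have "u (\<psi> * (p * q)) = - u (\<phi> * (p * pderiv q)) - u (\<phi> * (q * pderiv p))"
    by (simp add: fderiv_def fmul_def pderiv_mult distrib_left mult_ac functional_linear_rules[OF lin])
  then have "- u (\<phi> * q * pderiv p) = u (\<phi> * pderiv q * p) + u (\<psi> * q * p)"
    by (simp add: mult_ac)
  then show "fderiv ((q * \<phi>) \<odot> u) p = ((\<phi> * pderiv q + \<psi> * q) \<odot> u) p"
    by (simp add: fderiv_def fmul_def distrib_left distrib_right mult_ac functional_linear_rules[OF lin])
qed

text \<open>The recursion of the complementary polynomials, with a free parameter in place of \<open>n\<close>: besides
\<open>s = n\<close>, the value \<open>s = 0\<close> describes the exponential functional, and \<open>s = n - \<mu>\<close> the family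
shifted by \<open>\<mu>\<close>.\<close>

definition raising_recursion ::
  "complex poly \<Rightarrow> complex poly \<Rightarrow> complex \<Rightarrow> (nat \<Rightarrow> complex poly) \<Rightarrow> bool" where
  "raising_recursion \<phi> \<psi> s c \<longleftrightarrow> (\<forall>\<nu>. c (Suc \<nu>) =
     \<phi> * pderiv (c \<nu>) + (\<psi> + smult (s - of_nat \<nu> - 1) (pderiv \<phi>)) * c \<nu>)"

text \<open>The powers of \<open>\<phi>\<close> in front of the derivatives turn \<open>u\<^sup>(\<^sup>k\<^sup>)\<close> into a polynomial multiple of \<open>u\<close>:
differentiating \<open>\<phi>\<^sup>ku\<^sup>(\<^sup>k\<^sup>) = c\<^sub>ku\<close> and multiplying by \<open>\<phi>\<close> yields
\<open>\<phi>\<^sup>k\<^sup>+\<^sup>1u\<^sup>(\<^sup>k\<^sup>+\<^sup>1\<^sup>) = \<phi>(c\<^sub>ku)' - k\<phi>'c\<^sub>ku\<close>, and the Pearson equation removes the remaining derivative of \<open>u\<close>.\<close>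

lemma exp_functional_raising:
  assumes lin: "functional_linear u" and pearson: "fderiv (\<phi> \<odot> u) = \<psi> \<odot> u"
    and rec: "raising_recursion \<phi> \<psi> 0 c" and "c 0 = 1"
  shows "exp_functional \<phi> u k = smult (1 / fact k) (c k) \<odot> u"
proof -
  have "\<phi> ^ k \<odot> (fderiv ^^ k) u = c k \<odot> u"
  proof (induction k)
    case 0
    then show ?case by (simp add: \<open>c 0 = 1\<close>)
  next
    case (Suc k)
    show ?case
    proof
      fix p
      let ?w = "(fderiv ^^ k) u"
      have w: "?w (\<phi> ^ k * q) = u (c k * q)" for q
        using fun_cong[OF Suc.IH, of q] by (simp add: fmul_def)
      \<comment> \<open>the product rule moves the derivative off the powers of \<open>\<phi>\<close>\<close>
      have pd: "pderiv (\<phi> ^ Suc k * p) =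
          \<phi> ^ k * (smult (of_nat k + 1) (pderiv \<phi>) * p + \<phi> * pderiv p)"
        unfolding pderiv_mult pderiv_power_Suc by (simp add: algebra_simps)
      have "(\<phi> ^ Suc k \<odot> (fderiv ^^ Suc k) u) p = - ?w (pderiv (\<phi> ^ Suc k * p))"
        by (simp add: fmul_def fderiv_def)
      also have "\<dots> = - u (c k * (smult (of_nat k + 1) (pderiv \<phi>) * p + \<phi> * pderiv p))"
        by (simp only: pd w)
      also have "\<dots> = fderiv ((c k * \<phi>) \<odot> u) p - u (smult (of_nat k + 1) (pderiv \<phi>) * c k * p)"
        by (simp add: fderiv_def fmul_def functional_linear_rules[OF lin] distrib_left distrib_right mult_ac)
      also have "\<dots> = u ((\<phi> * pderiv (c k) + (\<psi> + smult (0 - of_nat k - 1) (pderiv \<phi>)) * c k) * p)"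
        unfolding pearson_fderiv[OF lin pearson]
        by (simp add: fmul_def functional_linear_rules[OF lin] algebra_simps)
      also have "\<dots> = (c (Suc k) \<odot> u) p"
        using rec by (simp add: fmul_def raising_recursion_def)
      finally show "(\<phi> ^ Suc k \<odot> (fderiv ^^ Suc k) u) p = (c (Suc k) \<odot> u) p" .
    qed
  qed
  then have "(\<phi> ^ k \<odot> (fderiv ^^ k) u) (smult (1 / fact k) p) = (c k \<odot> u) (smult (1 / fact k) p)" for p
    by simp
  then show ?thesis
    by (simp add: exp_functional_def fmul_def fun_eq_iff)
qed

text \<open>The defining relation of index 0 differs from Rodrigues' formula only by the factor \<open>C 0 n\<close>.
For \<open>\<nu> < n\<close>, injectivity of the derivative reduces two consecutive defining relations to
\<open>(C\<^sub>\<nu>\<phi>\<^sup>k\<^sup>+\<^sup>1u)' = C\<^sub>\<nu>\<^sub>+\<^sub>1\<phi>\<^sup>ku\<close> with \<open>k = n - \<nu> - 1\<close>; the Pearson equation evaluates the left side,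
and regularity together with \<open>\<phi> \<noteq> 0\<close> allows \<open>\<phi>\<^sup>ku\<close> to be cancelled.\<close>

lemma complementary_raising:
  assumes lin: "functional_linear u" and pearson: "fderiv (\<phi> \<odot> u) = \<psi> \<odot> u"
    and regular: "\<And>p q. p \<odot> u = q \<odot> u \<Longrightarrow> p = q"
    and "\<phi> \<noteq> 0"
    and B_nonzero: "\<And>k. B k \<noteq> 0"
    and rodrigues: "\<And>k. P k \<odot> u = fscale (B k) ((fderiv ^^ k) (shifted_functional \<phi> u k))"
    and compl: "complementary_polynomials \<phi> \<psi> u P B C"
  shows "C 0 n = 1" and "raising_recursion \<phi> \<psi> (of_nat n) (\<lambda>\<nu>. C \<nu> n)"
proof -
  have cancel: "v = w" if "fscale (B n) ((fderiv ^^ k) v) = fscale (B n) ((fderiv ^^ k) w)" for k v w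
  proof -
    have "(fderiv ^^ k) v = (fderiv ^^ k) w"
      using that B_nonzero[of n] by (simp add: fscale_def fun_eq_iff)
    then show ?thesis by (rule injD[OF inj_fn[OF inj_fderiv]])
  qed
  have C: "P n \<odot> u = fscale (B n) ((fderiv ^^ (n - \<nu>)) (C \<nu> n \<odot> shifted_functional \<phi> u (n - \<nu>)))"
    if "\<nu> \<le> n" for \<nu>
    using compl that unfolding complementary_polynomials_def by blast
  have "C 0 n \<odot> shifted_functional \<phi> u n = shifted_functional \<phi> u n"
  proof (rule cancel)
    show "fscale (B n) ((fderiv ^^ n) (C 0 n \<odot> shifted_functional \<phi> u n)) =
        fscale (B n) ((fderiv ^^ n) (shifted_functional \<phi> u n))"
      using C[of 0] rodrigues[of n] by simp
  qed
  then have "(C 0 n * \<phi> ^ n) \<odot> u = \<phi> ^ n \<odot> u"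
    by (simp add: shifted_functional_eq fmul_fmul)
  then have "C 0 n * \<phi> ^ n = \<phi> ^ n" by (rule regular)
  then show "C 0 n = 1" using \<open>\<phi> \<noteq> 0\<close> by simp
  show "raising_recursion \<phi> \<psi> (of_nat n) (\<lambda>\<nu>. C \<nu> n)"
    unfolding raising_recursion_def
  proof
    fix \<nu>
    show "C (Suc \<nu>) n = \<phi> * pderiv (C \<nu> n) + (\<psi> + smult (of_nat n - of_nat \<nu> - 1) (pderiv \<phi>)) * C \<nu> n"
    proof (cases "\<nu> < n")
      case False
      have "\<forall>n. \<forall>\<nu>\<ge>n. C (Suc \<nu>) n =
          \<phi> * pderiv (C \<nu> n) + (\<psi> + smult (of_nat n - of_nat \<nu> - 1) (pderiv \<phi>)) * C \<nu> n"
        using compl unfolding complementary_polynomials_def by (rule conjunct2)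
      with False show ?thesis by (meson not_less)
    next
      case True
      define k where "k = n - Suc \<nu>"
      have k: "n - \<nu> = Suc k" using True by (simp add: k_def)
      have kc: "of_nat n - of_nat \<nu> - 1 = (of_nat k :: complex)"
        using True by (simp add: k_def of_nat_diff)
      \<comment> \<open>the relations of index \<open>\<nu>\<close> and \<open>\<nu> + 1\<close> differ by one derivative\<close>
      have "fscale (B n) ((fderiv ^^ k) (fderiv (C \<nu> n \<odot> shifted_functional \<phi> u (Suc k)))) =
          fscale (B n) ((fderiv ^^ k) (C (Suc \<nu>) n \<odot> shifted_functional \<phi> u k))"
        using C[of \<nu>] C[of "Suc \<nu>"] True
        by (simp only: k k_def[symmetric] less_imp_le Suc_leI funpow_Suc_right comp_apply)
      then have "fderiv (C \<nu> n \<odot> shifted_functional \<phi> u (Suc k)) = C (Suc \<nu>) n \<odot> shifted_functional \<phi> u k"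
        by (rule cancel)
      then have "fderiv ((C \<nu> n * \<phi> ^ k * \<phi>) \<odot> u) = (C (Suc \<nu>) n * \<phi> ^ k) \<odot> u"
        by (simp only: shifted_functional_eq fmul_fmul power_Suc2 mult.assoc)
      then have "\<phi> * pderiv (C \<nu> n * \<phi> ^ k) + \<psi> * (C \<nu> n * \<phi> ^ k) = C (Suc \<nu>) n * \<phi> ^ k"
        unfolding pearson_fderiv[OF lin pearson] by (rule regular)
      moreover have "\<phi> * pderiv (\<phi> ^ k) = smult (of_nat k) (pderiv \<phi>) * \<phi> ^ k"
        by (cases k) (simp_all add: pderiv_power_Suc mult_ac del: power_Suc of_nat_Suc,
            simp add: mult_ac del: of_nat_Suc)
      moreover have "\<phi> * pderiv (C \<nu> n * \<phi> ^ k) =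
          C \<nu> n * (\<phi> * pderiv (\<phi> ^ k)) + \<phi> * pderiv (C \<nu> n) * \<phi> ^ k"
        by (simp add: pderiv_mult algebra_simps)
      ultimately have "C (Suc \<nu>) n * \<phi> ^ k =
          (\<phi> * pderiv (C \<nu> n) + (\<psi> + smult (of_nat k) (pderiv \<phi>)) * C \<nu> n) * \<phi> ^ k"
        by (simp add: algebra_simps)
      then show ?thesis using \<open>\<phi> \<noteq> 0\<close> by (simp add: kc)
    qed
  qed
qed

section \<open>A first-order operator that annihilates functions of the shifted argument\<close>

definition fps_xderiv :: "complex poly fps \<Rightarrow> complex poly fps" where
  "fps_xderiv A = Abs_fps (\<lambda>k. pderiv (fps_nth A k))"

lemma fps_xderiv_simps [simp]:
  "fps_xderiv (A + B) = fps_xderiv A + fps_xderiv B"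
  "fps_xderiv (fps_const p) = fps_const (pderiv p)"
  "fps_xderiv fps_X = 0"
  "fps_xderiv 1 = 0"
  "fps_xderiv 0 = 0"
  by (auto simp: fps_xderiv_def fps_eq_iff pderiv_add fps_X_nth)

lemma pderiv_sum: "pderiv (sum f A) = (\<Sum>i\<in>A. pderiv (f i))"
  using higher_pderiv_sum[of 1 f A] by simp

lemma fps_xderiv_mult [simp]: "fps_xderiv (A * B) = A * fps_xderiv B + B * fps_xderiv A"
proof (rule fps_ext)
  fix k
  have "fps_nth (fps_xderiv A * B) k = (\<Sum>i=0..k. fps_nth B (k - i) * pderiv (fps_nth A i))"
    unfolding fps_mult_nth by (simp add: fps_xderiv_def mult.commute)
  then have "fps_nth (B * fps_xderiv A) k = (\<Sum>i=0..k. fps_nth B (k - i) * pderiv (fps_nth A i))"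
    by (simp only: mult.commute)
  then show "fps_nth (fps_xderiv (A * B)) k = fps_nth (A * fps_xderiv B + B * fps_xderiv A) k"
    by (simp add: fps_mult_nth fps_xderiv_def pderiv_sum pderiv_mult sum.distrib)
qed

text \<open>A derivation in the directions \<open>y\<close> and \<open>x\<close>. Its characteristics are the curves on which
\<open>x + y\<phi>(x)\<close> is constant.\<close>

definition flow_op :: "complex poly \<Rightarrow> complex poly fps \<Rightarrow> complex poly fps" where
  "flow_op \<phi> A = (1 + fps_X * fps_const (pderiv \<phi>)) * fps_deriv A - fps_const \<phi> * fps_xderiv A"

lemma flow_op_mult: "flow_op \<phi> (A * B) = A * flow_op \<phi> B + B * flow_op \<phi> A"
  by (simp add: flow_op_def algebra_simps)

lemma flow_op_1 [simp]: "flow_op \<phi> 1 = 0"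
  by (simp add: flow_op_def)

text \<open>Eigenvalues of a derivation add up under products. They may depend on \<open>x\<close>, but not on \<open>y\<close>.\<close>

lemma flow_op_eigen_mult:
  assumes "flow_op \<phi> A = fps_const a * A" "flow_op \<phi> B = fps_const b * B"
  shows "flow_op \<phi> (A * B) = fps_const (a + b) * (A * B)"
  by (simp add: flow_op_mult assms algebra_simps flip: fps_const_add)

lemma flow_op_eigen_power:
  assumes "flow_op \<phi> A = fps_const a * A"
  shows "flow_op \<phi> (A ^ k) = fps_const (of_nat k * a) * A ^ k"
proof (induction k)
  case (Suc k)
  from flow_op_eigen_mult[OF assms Suc.IH] show ?case by (simp add: algebra_simps)
qed simp

lemma flow_op_nth:
  "fps_nth (flow_op \<phi> A) k =
    smult (of_nat (Suc k)) (fps_nth A (Suc k)) + pderiv \<phi> * smult (of_nat k) (fps_nth A k)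
    - \<phi> * pderiv (fps_nth A k)"
  unfolding flow_op_def
  by (cases k) (simp_all add: distrib_right mult.assoc fps_xderiv_def of_nat_poly algebra_simps)

text \<open>At order \<open>y\<^sup>k\<close> the equation determines the coefficient of \<open>y\<^sup>k\<^sup>+\<^sup>1\<close> from that of \<open>y\<^sup>k\<close>, since
\<open>k + 1\<close> can be cancelled in characteristic 0.\<close>

lemma flow_op_unique:
  assumes "flow_op \<phi> A = fps_const a * A" "flow_op \<phi> B = fps_const a * B"
    and "fps_nth A 0 = fps_nth B 0"
  shows "A = B"
proof (rule fps_ext)
  fix k show "fps_nth A k = fps_nth B k"
  proof (induction k)
    case (Suc k)
    have "fps_nth (flow_op \<phi> A) k = fps_nth (flow_op \<phi> B) k"
      by (simp add: assms Suc.IH)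
    then have "smult (of_nat (Suc k)) (fps_nth A (Suc k)) = smult (of_nat (Suc k)) (fps_nth B (Suc k))"
      unfolding flow_op_nth by (simp add: Suc.IH)
    then show ?case by (metis of_nat_neq_0 smult_cancel)
  qed (use assms in simp)
qed

text \<open>By the chain rule \<open>\<partial>\<^sub>y\<close> and \<open>\<partial>\<^sub>x\<close> of \<open>p(x + y\<phi>(x))\<close> are \<open>\<phi>\<close> and \<open>1 + y\<phi>'\<close> times the same
series. In the induction only the argument \<open>x + y\<phi>(x)\<close> itself has to be checked.\<close>

lemma flow_op_taylor_shift: "flow_op \<phi> (taylor_shift \<phi> p) = 0"
proof (induction p)
  case 0
  then show ?case by (simp add: taylor_shift_def flow_op_def)
next
  case (pCons a p)
  have "flow_op \<phi> (fps_const [:0, 1:] + fps_X * fps_const \<phi>) = 0"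
    by (simp add: flow_op_def pderiv_pCons algebra_simps)
  moreover have "flow_op \<phi> (fps_const [:a:] + A) = flow_op \<phi> A" for A
    by (simp add: flow_op_def pderiv_pCons algebra_simps)
  ultimately show ?case
    by (simp add: taylor_shift_pCons flow_op_mult pCons.IH)
qed

text \<open>Apply the operator to \<open>\<phi>\<close> times the ratio: the product is annihilated, while \<open>\<phi>\<close> itself has
eigenvalue \<open>-\<phi>'\<close>.\<close>

lemma flow_op_shift_ratio:
  assumes "\<phi> \<noteq> 0"
  shows "flow_op \<phi> (shift_ratio \<phi>) = fps_const (pderiv \<phi>) * shift_ratio \<phi>"
proof -
  have c: "flow_op \<phi> (fps_const \<phi>) = - (fps_const \<phi> * fps_const (pderiv \<phi>))"
    by (simp add: flow_op_def del: fps_const_mult fps_const_neg)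
  have "0 = flow_op \<phi> (fps_const \<phi> * shift_ratio \<phi>)"
    by (simp add: shift_ratio_exact flow_op_taylor_shift)
  also have "\<dots> = fps_const \<phi> * (flow_op \<phi> (shift_ratio \<phi>) - fps_const (pderiv \<phi>) * shift_ratio \<phi>)"
    by (simp add: flow_op_mult c algebra_simps del: fps_const_mult fps_const_neg)
  finally show ?thesis using assms by simp
qed

lemma flow_op_shift_ratio_powi:
  assumes "\<phi> \<noteq> 0"
  shows "flow_op \<phi> (shift_ratio_powi \<phi> k) =
    fps_const (smult (of_int k) (pderiv \<phi>)) * shift_ratio_powi \<phi> k"
proof (cases "0 \<le> k")
  case True
  then show ?thesis
    using flow_op_eigen_power[OF flow_op_shift_ratio[OF assms], of "nat k"]
    by (simp add: shift_ratio_powi_def of_nat_poly)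
next
  case False
  let ?S = "shift_ratio \<phi>" and ?I = "fps_right_inverse (shift_ratio \<phi>) 1"
  have SI: "?S * ?I = 1" by (rule shift_ratio_inverse[OF assms])
  then have "?S \<noteq> 0" by auto
  have "0 = flow_op \<phi> (?S * ?I)" by (simp add: SI)
  also have "\<dots> = ?S * (flow_op \<phi> ?I + fps_const (pderiv \<phi>) * ?I)"
    by (simp add: flow_op_mult flow_op_shift_ratio[OF assms] algebra_simps)
  finally have "flow_op \<phi> ?I + fps_const (pderiv \<phi>) * ?I = 0"
    using \<open>?S \<noteq> 0\<close> by simp
  then have "flow_op \<phi> ?I = fps_const (- pderiv \<phi>) * ?I"
    by (simp add: add_eq_0_iff flip: fps_const_neg)
  then show ?thesis
    using flow_op_eigen_power[of \<phi> ?I "- pderiv \<phi>" "nat (- k)"] False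
    by (simp add: shift_ratio_powi_def of_nat_poly)
qed

lemma shift_ratio_powi_nth_0:
  assumes "\<phi> \<noteq> 0"
  shows "fps_nth (shift_ratio_powi \<phi> k) 0 = 1"
  using assms by (simp add: shift_ratio_powi_def shift_ratio_def taylor_shift_nth_0 fps_power_zeroth)

definition exp_series :: "(nat \<Rightarrow> complex poly) \<Rightarrow> complex poly fps" where
  "exp_series c = Abs_fps (\<lambda>\<nu>. smult (1 / fact \<nu>) (c \<nu>))"

lemma exp_series_nth_0 [simp]: "fps_nth (exp_series c) 0 = c 0"
  by (simp add: exp_series_def)

lemma fps_deriv_exp_series: "fps_deriv (exp_series c) = exp_series (\<lambda>\<nu>. c (Suc \<nu>))"
  by (rule fps_ext) (simp add: exp_series_def of_nat_poly field_simps del: of_nat_Suc)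

lemma fps_nth_deriv_exp_series: "fps_nth_deriv m (exp_series c) = exp_series (\<lambda>\<nu>. c (\<nu> + m))"
  by (induction m arbitrary: c) (simp_all add: fps_deriv_exp_series)

text \<open>The term \<open>-\<nu>\<phi>'c\<^sub>\<nu>\<close> of the recursion is the coefficient of \<open>-y\<phi>'\<partial>\<^sub>y\<close>; this is the origin of the
factor \<open>1 + y\<phi>'\<close> in the operator.\<close>

lemma flow_op_exp_series:
  assumes "raising_recursion \<phi> \<psi> s c"
  shows "flow_op \<phi> (exp_series c) = fps_const (\<psi> + smult (s - 1) (pderiv \<phi>)) * exp_series c"
proof (rule fps_ext)
  fix k
  have "smult (of_nat (Suc k)) (smult (1 / fact (Suc k)) (c (Suc k))) = smult (1 / fact k) (c (Suc k))"
    by (simp add: field_simps del: of_nat_Suc)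
  also have "\<dots> = smult (1 / fact k)
      (\<phi> * pderiv (c k) + (\<psi> + smult (s - of_nat k - 1) (pderiv \<phi>)) * c k)"
    using assms unfolding raising_recursion_def by simp
  finally have *: "smult (of_nat (Suc k)) (smult (1 / fact (Suc k)) (c (Suc k))) = \<dots>" .
  show "fps_nth (flow_op \<phi> (exp_series c)) k =
      fps_nth (fps_const (\<psi> + smult (s - 1) (pderiv \<phi>)) * exp_series c) k"
    unfolding flow_op_nth exp_series_def fps_nth_Abs_fps *
    by (simp add: pderiv_smult smult_add_right smult_diff_right smult_diff_left smult_add_left algebra_simps)
qed

text \<open>Both sides have the eigenvalue \<open>\<psi> + (n - m - 1)\<phi>'\<close>. On the left, the family shifted by \<open>m\<close>
satisfies the recursion with parameter \<open>n - m\<close>; on the right, the ratio contributes \<open>(n - m)\<phi>'\<close>, the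
shifted polynomial 0 and the last factor \<open>\<psi> - \<phi>'\<close>. Both start with \<open>c m\<close> at \<open>y = 0\<close>.\<close>

lemma raising_closed_form:
  assumes "\<phi> \<noteq> 0"
    and c: "raising_recursion \<phi> \<psi> (of_nat n) c"
    and e: "raising_recursion \<phi> \<psi> 0 e" "e 0 = 1"
  shows "fps_nth_deriv m (exp_series c) =
    shift_ratio_powi \<phi> (int n - int m) * taylor_shift \<phi> (c m) * exp_series e"
proof (rule flow_op_unique)
  have "raising_recursion \<phi> \<psi> (of_nat n - of_nat m) (\<lambda>\<nu>. c (\<nu> + m))"
    using c unfolding raising_recursion_def by (simp add: algebra_simps)
  from flow_op_exp_series[OF this]
  show "flow_op \<phi> (fps_nth_deriv m (exp_series c)) =
      fps_const (\<psi> + smult (of_nat n - of_nat m - 1) (pderiv \<phi>)) * fps_nth_deriv m (exp_series c)"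
    by (simp add: fps_nth_deriv_exp_series)
  have "flow_op \<phi> (taylor_shift \<phi> (c m)) = fps_const 0 * taylor_shift \<phi> (c m)"
    by (simp add: flow_op_taylor_shift)
  note * = flow_op_eigen_mult[OF flow_op_eigen_mult[OF flow_op_shift_ratio_powi[OF \<open>\<phi> \<noteq> 0\<close>] this]
      flow_op_exp_series[OF e(1)], of "int n - int m"]
  have "smult (of_int (int n - int m)) (pderiv \<phi>) + 0 + (\<psi> + smult (0 - 1) (pderiv \<phi>)) =
      \<psi> + smult (of_nat n - of_nat m - 1) (pderiv \<phi>)"
    by (simp add: smult_diff_left)
  then show "flow_op \<phi> (shift_ratio_powi \<phi> (int n - int m) * taylor_shift \<phi> (c m) * exp_series e) =
      fps_const (\<psi> + smult (of_nat n - of_nat m - 1) (pderiv \<phi>)) *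
      (shift_ratio_powi \<phi> (int n - int m) * taylor_shift \<phi> (c m) * exp_series e)"
    using * by simp
  show "fps_nth (fps_nth_deriv m (exp_series c)) 0 =
      fps_nth (shift_ratio_powi \<phi> (int n - int m) * taylor_shift \<phi> (c m) * exp_series e) 0"
    using e(2) by (simp add: fps_nth_deriv_exp_series taylor_shift_nth_0
        shift_ratio_powi_nth_0[OF \<open>\<phi> \<noteq> 0\<close>])
qed

section \<open>Convergence of the exponential functional\<close>

text \<open>The weighted \<open>\<ell>\<^sup>1\<close> norm of the coefficients, with weight \<open>R\<^sup>i\<close> on the coefficient of \<open>x\<^sup>i\<close>.\<close>

definition coeff_norm :: "real \<Rightarrow> complex poly \<Rightarrow> real" where
  "coeff_norm R p = poly (map_poly norm p) R"

lemma coeff_norm_0 [simp]: "coeff_norm R 0 = 0"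
  by (simp add: coeff_norm_def)

lemma coeff_norm_pCons [simp]: "coeff_norm R (pCons a p) = norm a + R * coeff_norm R p"
  by (simp add: coeff_norm_def map_poly_pCons)

lemma coeff_norm_altdef: "coeff_norm R p = (\<Sum>i\<le>degree p. norm (coeff p i) * R ^ i)"
proof (cases "p = 0")
  case False
  then have "degree (map_poly norm p) = degree p" by (intro map_poly_degree_eq) simp
  then show ?thesis by (simp add: coeff_norm_def poly_altdef coeff_map_poly)
qed simp

lemma coeff_norm_smult [simp]: "coeff_norm R (smult c p) = norm c * coeff_norm R p"
  by (induction p) (simp_all add: norm_mult algebra_simps)

lemma coeff_norm_nonneg: "0 \<le> R \<Longrightarrow> 0 \<le> coeff_norm R p"
  by (induction p) simp_all

lemma coeff_norm_add:
  assumes "0 \<le> R"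
  shows "coeff_norm R (p + q) \<le> coeff_norm R p + coeff_norm R q"
proof (induction p q rule: poly_induct2)
  case (pCons a p b q)
  have "norm (a + b) + R * coeff_norm R (p + q) \<le>
      (norm a + norm b) + R * (coeff_norm R p + coeff_norm R q)"
    by (intro add_mono norm_triangle_ineq mult_left_mono pCons.IH assms)
  then show ?case by (simp add: algebra_simps)
qed simp

lemma coeff_norm_mult:
  assumes "0 \<le> R"
  shows "coeff_norm R (p * q) \<le> coeff_norm R p * coeff_norm R q"
proof (induction p)
  case (pCons a p)
  have "coeff_norm R (pCons a p * q) \<le> coeff_norm R (smult a q) + coeff_norm R (pCons 0 (p * q))"
    unfolding mult_pCons_left by (rule coeff_norm_add[OF assms])
  also have "\<dots> \<le> norm a * coeff_norm R q + R * (coeff_norm R p * coeff_norm R q)"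
    using mult_left_mono[OF pCons.IH assms] by simp
  finally show ?case by (simp add: algebra_simps)
qed simp

lemma coeff_norm_power:
  assumes "0 \<le> R"
  shows "coeff_norm R (p ^ k) \<le> coeff_norm R p ^ k"
proof (induction k)
  case (Suc k)
  have "coeff_norm R (p ^ Suc k) \<le> coeff_norm R p * coeff_norm R (p ^ k)"
    using coeff_norm_mult[OF assms] by simp
  also have "\<dots> \<le> coeff_norm R p * coeff_norm R p ^ k"
    by (intro mult_left_mono Suc.IH coeff_norm_nonneg assms)
  finally show ?case by simp
qed (simp add: one_pCons)

lemma higher_pderiv_pCons:
  "(pderiv ^^ Suc k) (pCons a p) =
    smult (of_nat (Suc k)) ((pderiv ^^ k) p) + pCons 0 ((pderiv ^^ Suc k) p)"
proof (induction k)
  case 0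
  then show ?case by (simp add: pderiv_pCons)
next
  case (Suc k)
  have "(pderiv ^^ Suc (Suc k)) (pCons a p) = pderiv ((pderiv ^^ Suc k) (pCons a p))" by simp
  also have "\<dots> = pderiv (smult (of_nat (Suc k)) ((pderiv ^^ k) p) + pCons 0 ((pderiv ^^ Suc k) p))"
    by (simp only: Suc.IH)
  also have "\<dots> = smult (of_nat (Suc (Suc k))) ((pderiv ^^ Suc k) p) + pCons 0 ((pderiv ^^ Suc (Suc k)) p)"
    by (simp add: pderiv_add pderiv_smult pderiv_pCons smult_add_left add_ac)
  finally show ?case .
qed

text \<open>The derivatives divided by \<open>k!\<close> are the terms of the Taylor expansion of \<open>p(x + 1)\<close> at \<open>x\<close>; on
monomials the estimate is the bound of one term of the binomial expansion of \<open>(R + 1)\<^sup>i\<close> by the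
whole sum. Passing from \<open>R\<close> to \<open>R + 1\<close> thus absorbs the derivatives with a loss independent of
\<open>k\<close> and of the degree.\<close>

lemma coeff_norm_higher_pderiv:
  assumes "0 \<le> R"
  shows "coeff_norm R ((pderiv ^^ k) p) \<le> fact k * coeff_norm (R + 1) p"
proof (induction p arbitrary: k)
  case 0
  show ?case by (simp add: higher_pderiv_0)
next
  case (pCons a p)
  show ?case
  proof (cases k)
    case 0
    have "R * coeff_norm R p \<le> (R + 1) * coeff_norm (R + 1) p"
      using pCons.IH[of 0] assms coeff_norm_nonneg[OF assms, of p] by (intro mult_mono) auto
    then show ?thesis by (simp add: 0)
  next
    case (Suc j)
    have "coeff_norm R ((pderiv ^^ k) (pCons a p)) \<le>
        of_nat (Suc j) * coeff_norm R ((pderiv ^^ j) p) + R * coeff_norm R ((pderiv ^^ Suc j) p)"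
      unfolding Suc higher_pderiv_pCons
      by (rule order_trans[OF coeff_norm_add[OF assms]]) (simp add: norm_of_nat del: of_nat_Suc funpow.simps)
    also have "\<dots> \<le> of_nat (Suc j) * (fact j * coeff_norm (R + 1) p) +
        R * (fact (Suc j) * coeff_norm (R + 1) p)"
      by (intro add_mono mult_left_mono pCons.IH assms) simp
    also have "\<dots> = fact k * ((R + 1) * coeff_norm (R + 1) p)"
      by (simp add: Suc algebra_simps)
    also have "\<dots> \<le> fact k * coeff_norm (R + 1) (pCons a p)"
      by (intro mult_left_mono) auto
    finally show ?thesis .
  qed
qed

lemma functional_bound:
  assumes lin: "functional_linear u"
    and moments: "\<And>i. i \<le> degree p \<Longrightarrow> norm (u (monom 1 i)) \<le> M * R ^ i"
  shows "norm (u p) \<le> M * coeff_norm R p"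
proof -
  have "u p = u (\<Sum>i\<le>degree p. monom (coeff p i) i)" by (simp add: poly_as_sum_of_monoms)
  also have "\<dots> = (\<Sum>i\<le>degree p. coeff p i * u (monom 1 i))"
    unfolding functional_sum[OF lin] functional_smult[OF lin, symmetric] by (simp add: smult_monom)
  finally have "norm (u p) \<le> (\<Sum>i\<le>degree p. norm (coeff p i) * norm (u (monom 1 i)))"
    by (simp add: order_trans[OF norm_sum] norm_mult)
  also have "\<dots> \<le> (\<Sum>i\<le>degree p. norm (coeff p i) * (M * R ^ i))"
    by (intro sum_mono mult_left_mono moments) auto
  finally show ?thesis by (simp add: coeff_norm_altdef sum_distrib_left mult_ac)
qed

text \<open>The Pearson equation tested on \<open>x\<^sup>k\<^sup>+\<^sup>1\<close>.\<close>

lemma pearson_moments: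
  assumes lin: "functional_linear u" and pearson: "fderiv (\<phi> \<odot> u) = \<psi> \<odot> u"
    and "degree \<phi> \<le> 2" "degree \<psi> \<le> 1"
  shows "(of_nat (Suc k) * coeff \<phi> 2 + coeff \<psi> 1) * u (monom 1 (Suc (Suc k))) =
    - (of_nat (Suc k) * coeff \<phi> 1 + coeff \<psi> 0) * u (monom 1 (Suc k))
    - of_nat (Suc k) * coeff \<phi> 0 * u (monom 1 k)"
proof -
  define a b c p q where "a = coeff \<phi> 2" and "b = coeff \<phi> 1" and "c = coeff \<phi> 0"
    and "p = coeff \<psi> 1" and "q = coeff \<psi> 0"
  have \<phi>: "\<phi> = [:c, b, a:]"
  proof (rule poly_eqI)
    fix i
    show "coeff \<phi> i = coeff [:c, b, a:] i"
    proof (cases "i \<le> 2")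
      case True
      then have "i = 0 \<or> i = 1 \<or> i = 2" by auto
      then show ?thesis by (auto simp: a_def b_def c_def numeral_2_eq_2)
    next
      case False
      then show ?thesis using assms(3)
        by (auto simp: coeff_pCons coeff_eq_0 split: nat.split)
    qed
  qed
  have \<psi>: "\<psi> = [:q, p:]"
  proof (rule poly_eqI)
    fix i
    show "coeff \<psi> i = coeff [:q, p:] i"
      using assms(4) by (cases i) (auto simp: q_def p_def coeff_pCons coeff_eq_0 split: nat.split)
  qed
  let ?m = "\<lambda>i. monom (1 :: complex) i"
  have \<phi>m: "\<phi> * ?m k = smult c (?m k) + smult b (?m (Suc k)) + smult a (?m (Suc (Suc k)))"
    by (simp add: \<phi> smult_monom monom_Suc)
  have \<psi>m: "\<psi> * ?m (Suc k) = smult q (?m (Suc k)) + smult p (?m (Suc (Suc k)))"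
    by (simp add: \<psi> smult_monom monom_Suc)
  have "- u (\<phi> * pderiv (?m (Suc k))) = u (\<psi> * ?m (Suc k))"
    using fun_cong[OF pearson, of "?m (Suc k)"] by (simp add: fderiv_def fmul_def)
  moreover have "pderiv (?m (Suc k)) = smult (of_nat (Suc k)) (?m k)"
    by (simp add: pderiv_monom smult_monom)
  ultimately have "u (\<psi> * ?m (Suc k)) = - (of_nat (Suc k) * u (\<phi> * ?m k))"
    by (simp only: mult_smult_right functional_smult[OF lin])
  then have "q * u (?m (Suc k)) + p * u (?m (Suc (Suc k))) =
      - (of_nat (Suc k) * (c * u (?m k) + b * u (?m (Suc k)) + a * u (?m (Suc (Suc k)))))"
    unfolding \<phi>m \<psi>m by (simp only: functional_linear_rules[OF lin])
  then show ?thesis unfolding a_def[symmetric] b_def[symmetric] c_def[symmetric] p_def[symmetric] q_def[symmetric]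
    by algebra
qed

text \<open>If \<open>\<phi>\<close> has degree 2, the leading factor of the moment recursion grows linearly in \<open>k\<close>, as do
the factors on the right-hand side, so from some index on each moment is at most \<open>R\<close> times the
larger of the two preceding bounds.\<close>

lemma geometric_moments:
  assumes lin: "functional_linear u" and pearson: "fderiv (\<phi> \<odot> u) = \<psi> \<odot> u"
    and "degree \<phi> = 2" "degree \<psi> \<le> 1"
  obtains M R where "1 \<le> R" "\<And>i. norm (u (monom 1 i)) \<le> M * R ^ i"
proof -
  define a b c p q where "a = norm (coeff \<phi> 2)" and "b = norm (coeff \<phi> 1)"
    and "c = norm (coeff \<phi> 0)" and "p = norm (coeff \<psi> 1)" and "q = norm (coeff \<psi> 0)"
  define m where "m i = norm (u (monom 1 i))" for i
  have "a > 0" using \<open>degree \<phi> = 2\<close> unfolding a_def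
    by (metis degree_0 leading_coeff_0_iff zero_less_norm_iff zero_neq_numeral)
  \<comment> \<open>large enough that \<open>b + q + c \<le> a / 2 * R\<close>, which closes the induction\<close>
  define R where "R = 1 + 2 * (b + q + c) / a"
  have bqc: "0 \<le> b" "0 \<le> q" "0 \<le> c" "0 \<le> p" by (simp_all add: b_def q_def c_def p_def)
  have "1 \<le> R" using \<open>a > 0\<close> bqc by (simp add: R_def)
  \<comment> \<open>beyond \<open>K\<close> the leading factor of the recursion has modulus at least \<open>(k + 1)a / 2\<close>\<close>
  obtain K where K: "2 * p / a \<le> real K" using real_arch_simple by blast
  define M where "M = (\<Sum>i\<le>K + 1. m i)"
  have m_nonneg: "0 \<le> m i" for i by (simp add: m_def)
  have "m i \<le> M * R ^ i" for i
  proof (induction i rule: less_induct)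
    case (less i)
    have "0 \<le> M" unfolding M_def by (intro sum_nonneg m_nonneg)
    show ?case
    proof (cases "i \<le> K + 1")
      case True
      then have "m i \<le> M" unfolding M_def by (intro member_le_sum m_nonneg) auto
      also have "M \<le> M * R ^ i"
        using \<open>0 \<le> M\<close> one_le_power[OF \<open>1 \<le> R\<close>, of i] mult_left_mono[of 1 "R ^ i" M] by simp
      finally show ?thesis .
    next
      case False
      define k where "k = i - 2"
      have i: "i = Suc (Suc k)" and "K \<le> k" using False by (simp_all add: k_def)
      define s where "s = real (Suc k)"
      have "s \<ge> 1" by (simp add: s_def)
      have "2 * p \<le> s * a"
      proof -
        have "2 * p \<le> real K * a" using K \<open>a > 0\<close> by (simp add: field_simps)
        also have "\<dots> \<le> s * a" using \<open>K \<le> k\<close> \<open>a > 0\<close> by (intro mult_right_mono) (auto simp: s_def)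
        finally show ?thesis .
      qed
      have "s * a - p \<le> norm (of_nat (Suc k) * coeff \<phi> 2 + coeff \<psi> 1)"
        using norm_diff_ineq[of "of_nat (Suc k) * coeff \<phi> 2" "coeff \<psi> 1"]
        by (simp add: norm_mult s_def a_def p_def norm_of_nat del: of_nat_Suc)
      then have "s * a / 2 \<le> norm (of_nat (Suc k) * coeff \<phi> 2 + coeff \<psi> 1)"
        using \<open>2 * p \<le> s * a\<close> by linarith
      then have "s * a / 2 * m i \<le> norm (of_nat (Suc k) * coeff \<phi> 2 + coeff \<psi> 1) * m i"
        by (intro mult_right_mono m_nonneg)
      also have "\<dots> = norm (- (of_nat (Suc k) * coeff \<phi> 1 + coeff \<psi> 0) * u (monom 1 (Suc k))
          - of_nat (Suc k) * coeff \<phi> 0 * u (monom 1 k))"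
        unfolding m_def i norm_mult[symmetric]
        using pearson_moments[OF lin pearson _ assms(4), of k] assms(3) by simp
      also have "\<dots> \<le> norm (of_nat (Suc k) * coeff \<phi> 1 + coeff \<psi> 0) * m (Suc k) + s * c * m k"
        by (rule order_trans[OF norm_triangle_ineq4])
          (simp only: norm_mult norm_minus_cancel norm_of_nat m_def s_def c_def order_refl)
      also have "\<dots> \<le> (s * b + q) * m (Suc k) + s * c * m k"
        using norm_triangle_ineq[of "of_nat (Suc k) * coeff \<phi> 1" "coeff \<psi> 0"]
        by (intro add_right_mono mult_right_mono m_nonneg)
          (simp only: norm_mult norm_of_nat s_def b_def q_def)
      also have "\<dots> \<le> (s * b + s * q) * m (Suc k) + s * c * m k"
        using bqc \<open>s \<ge> 1\<close> mult_right_mono[of 1 s q]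
        by (intro add_right_mono mult_right_mono m_nonneg) auto
      also have "\<dots> \<le> (s * b + s * q) * (M * R ^ Suc k) + s * c * (M * R ^ Suc k)"
      proof (intro add_mono mult_left_mono)
        show "m (Suc k) \<le> M * R ^ Suc k" by (rule less) (simp add: i)
        have "m k \<le> M * R ^ k" by (rule less) (simp add: i)
        also have "\<dots> \<le> M * R ^ Suc k"
          using \<open>0 \<le> M\<close> \<open>1 \<le> R\<close> by (intro mult_left_mono power_increasing) auto
        finally show "m k \<le> M * R ^ Suc k" .
      qed (use bqc \<open>s \<ge> 1\<close> in auto)
      also have "\<dots> = s * (b + q + c) * (M * R ^ Suc k)" by (simp add: algebra_simps)
      also have "\<dots> \<le> s * a / 2 * (M * R ^ i)"
      proof -
        have "b + q + c \<le> a / 2 * R" using \<open>a > 0\<close> by (simp add: R_def field_simps)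
        then have "s * (b + q + c) * (M * R ^ Suc k) \<le> s * (a / 2 * R) * (M * R ^ Suc k)"
          using \<open>s \<ge> 1\<close> \<open>0 \<le> M\<close> \<open>1 \<le> R\<close> by (intro mult_right_mono mult_left_mono) auto
        then show ?thesis by (simp add: i mult_ac)
      qed
      finally show ?thesis using \<open>a > 0\<close> \<open>s \<ge> 1\<close> by (simp add: mult_le_cancel_left_pos)
    qed
  qed
  with \<open>1 \<le> R\<close> show ?thesis using that by (auto simp: m_def)
qed

lemma degree_higher_pderiv_le: "degree ((pderiv ^^ k) p) \<le> degree p - k" for p :: "complex poly"
proof (induction k)
  case (Suc k)
  then show ?case using degree_pderiv[of "(pderiv ^^ k) p"] by simp
qed simp

text \<open>For \<open>degree \<phi> \<le> 1\<close> the moments can grow faster than geometrically, as for the Laguerre and Hermite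
functionals, and
\<open>functional_bound\<close> cannot be applied with one constant to all polynomials. But then
\<open>(\<phi>\<^sup>kq)\<^sup>(\<^sup>k\<^sup>)\<close> has degree at most that of \<open>q\<close>. The weight \<open>R\<close> must not depend on \<open>q\<close>, since it
determines the radius of convergence; the constant \<open>M\<close> may.\<close>

lemma derivative_form_bound:
  assumes lin: "functional_linear u" and pearson: "fderiv (\<phi> \<odot> u) = \<psi> \<odot> u"
    and "degree \<phi> \<le> 2" "degree \<psi> \<le> 1"
  obtains R where "1 \<le> R"
    "\<And>q. \<exists>M\<ge>0. \<forall>k. norm (u ((pderiv ^^ k) (\<phi> ^ k * q))) \<le> M * coeff_norm R ((pderiv ^^ k) (\<phi> ^ k * q))"
proof (cases "degree \<phi> = 2")
  case True
  obtain M R where MR: "1 \<le> R" "\<And>i. norm (u (monom 1 i)) \<le> M * R ^ i"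
    using geometric_moments[OF lin pearson True assms(4)] by blast
  have "0 \<le> M" using order_trans[OF norm_ge_zero MR(2)[of 0]] by simp
  then show ?thesis using that[OF MR(1)] functional_bound[OF lin MR(2)] by blast
next
  case False
  then have "degree \<phi> \<le> 1" using assms(3) by simp
  show ?thesis
  proof (rule that[of 1])
    fix q :: "complex poly"
    define M where "M = (\<Sum>i\<le>degree q. norm (u (monom 1 i)))"
    have "norm (u ((pderiv ^^ k) (\<phi> ^ k * q))) \<le> M * coeff_norm 1 ((pderiv ^^ k) (\<phi> ^ k * q))" for k
    proof (rule functional_bound[OF lin])
      fix i assume i: "i \<le> degree ((pderiv ^^ k) (\<phi> ^ k * q))"
      have "degree (\<phi> ^ k) \<le> k"
        using order_trans[OF degree_power_le mult_le_mono1[OF \<open>degree \<phi> \<le> 1\<close>]] by simp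
      then have "degree (\<phi> ^ k * q) - k \<le> degree q"
        using degree_mult_le[of "\<phi> ^ k" q] by linarith
      then have "i \<le> degree q"
        using i degree_higher_pderiv_le[of k "\<phi> ^ k * q"] by linarith
      then show "norm (u (monom 1 i)) \<le> M * 1 ^ i"
        unfolding M_def by simp (intro member_le_sum, auto)
    qed
    moreover have "0 \<le> M" unfolding M_def by (intro sum_nonneg) simp
    ultimately show "\<exists>M\<ge>0. \<forall>k. norm (u ((pderiv ^^ k) (\<phi> ^ k * q))) \<le>
        M * coeff_norm 1 ((pderiv ^^ k) (\<phi> ^ k * q))" by blast
  qed simp
qed

lemma fps_conv_radius_geometric:
  fixes f :: "complex fps"
  assumes "0 < A" "\<And>k. norm (fps_nth f k) \<le> M * A ^ k"
  shows "ereal (1 / A) \<le> fps_conv_radius f"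
  unfolding fps_conv_radius_def
proof (rule conv_radius_geI_ex')
  fix r :: real assume r: "0 < r" "ereal r < ereal (1 / A)"
  then have "A * r < 1" using \<open>0 < A\<close> by (simp add: field_simps)
  then have "summable (\<lambda>k. M * (A * r) ^ k)"
    using \<open>0 < A\<close> \<open>0 < r\<close> by (intro summable_mult summable_geometric) simp
  then show "summable (\<lambda>k. fps_nth f k * of_real r ^ k)"
  proof (rule summable_comparison_test')
    show "norm (fps_nth f k * of_real r ^ k) \<le> M * (A * r) ^ k" if "0 \<le> k" for k
      using mult_right_mono[OF assms(2)[of k], of "r ^ k"] \<open>0 < r\<close>
      by (simp add: norm_mult norm_power power_mult_distrib mult_ac)
  qed
qed

text \<open>Moving the derivatives to the polynomial side, the \<open>k\<close>-th coefficient of the pairing with \<open>q\<close> is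
\<open>\<plusminus>u((\<phi>\<^sup>kq)\<^sup>(\<^sup>k\<^sup>))/k!\<close>, which the preceding bounds and submultiplicativity of the norm estimate by
a constant depending on \<open>q\<close> times the \<open>k\<close>-th power of a norm of \<open>\<phi>\<close>.\<close>

lemma exp_functional_weakly_convergent:
  assumes lin: "functional_linear u" and pearson: "fderiv (\<phi> \<odot> u) = \<psi> \<odot> u"
    and "degree \<phi> \<le> 2" "degree \<psi> \<le> 1"
  shows "\<exists>\<epsilon>>0. weakly_convergent \<epsilon> (exp_functional \<phi> u)"
proof -
  obtain R where "1 \<le> R" and R: "\<And>q. \<exists>M\<ge>0. \<forall>k. norm (u ((pderiv ^^ k) (\<phi> ^ k * q))) \<le>
      M * coeff_norm R ((pderiv ^^ k) (\<phi> ^ k * q))"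
    using derivative_form_bound[OF assms] by blast
  \<comment> \<open>the summand 1 makes \<open>A\<close> positive, so that \<open>1 / A\<close> is a radius\<close>
  define A where "A = coeff_norm (R + 1) \<phi> + 1"
  have "0 < A" using coeff_norm_nonneg[of "R + 1" \<phi>] \<open>1 \<le> R\<close> by (simp add: A_def)
  have "ereal (1 / A) \<le> fps_conv_radius (pairing (exp_functional \<phi> u) q)" for q
  proof -
    obtain M where "0 \<le> M" and M: "\<And>k. norm (u ((pderiv ^^ k) (\<phi> ^ k * q))) \<le>
        M * coeff_norm R ((pderiv ^^ k) (\<phi> ^ k * q))" using R by blast
    show ?thesis
    proof (rule fps_conv_radius_geometric[OF \<open>0 < A\<close>])
      fix k
      have "fps_nth (pairing (exp_functional \<phi> u) q) k =
          (- 1) ^ k / fact k * u ((pderiv ^^ k) (\<phi> ^ k * q))"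
        by (simp add: pairing_def exp_functional_def fmul_def fderiv_pow_apply higher_pderiv_smult
            functional_smult[OF lin])
      then have "norm (fps_nth (pairing (exp_functional \<phi> u) q) k) =
          norm (u ((pderiv ^^ k) (\<phi> ^ k * q))) / fact k"
        by (simp add: norm_mult norm_divide norm_power)
      also have "\<dots> \<le> M * (fact k * coeff_norm (R + 1) (\<phi> ^ k * q)) / fact k"
        using \<open>0 \<le> M\<close> \<open>1 \<le> R\<close>
        by (intro divide_right_mono order_trans[OF M] mult_left_mono coeff_norm_higher_pderiv) auto
      also have "\<dots> = M * coeff_norm (R + 1) (\<phi> ^ k * q)" by simp
      also have "\<dots> \<le> M * (coeff_norm (R + 1) (\<phi> ^ k) * coeff_norm (R + 1) q)"
        using \<open>0 \<le> M\<close> \<open>1 \<le> R\<close> by (intro mult_left_mono coeff_norm_mult) auto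
      also have "\<dots> \<le> M * (A ^ k * coeff_norm (R + 1) q)"
      proof -
        have "coeff_norm (R + 1) (\<phi> ^ k) \<le> coeff_norm (R + 1) \<phi> ^ k"
          using \<open>1 \<le> R\<close> by (intro coeff_norm_power) simp
        also have "\<dots> \<le> A ^ k"
          using \<open>1 \<le> R\<close> coeff_norm_nonneg[of "R + 1" \<phi>] by (intro power_mono) (auto simp: A_def)
        finally show ?thesis
          using \<open>0 \<le> M\<close> \<open>1 \<le> R\<close> by (intro mult_left_mono mult_right_mono coeff_norm_nonneg) auto
      qed
      finally show "norm (fps_nth (pairing (exp_functional \<phi> u) q) k) \<le>
          (M * coeff_norm (R + 1) q) * A ^ k" by (simp add: mult_ac)
    qed
  qed
  then show ?thesis using \<open>0 < A\<close> unfolding weakly_convergent_def by (intro exI[of _ "1 / A"]) simp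
qed

section \<open>Evaluation of series of functionals\<close>

lemma functional_linear_fmul:
  assumes "functional_linear v"
  shows "functional_linear (q \<odot> v)"
  using assms unfolding Vector_Spaces.linear_iff
  by (simp add: fmul_def distrib_left)

lemma exp_functional_linear:
  assumes "functional_linear u"
  shows "functional_linear (exp_functional \<phi> u k)"
proof -
  have "functional_linear ((fderiv ^^ k) u)"
    using assms unfolding Vector_Spaces.linear_iff
    by (simp add: fderiv_pow_apply higher_pderiv_add higher_pderiv_smult distrib_left)
  then show ?thesis unfolding exp_functional_def by (rule functional_linear_fmul)
qed

lemma pairing_linear:
  assumes "\<And>k. functional_linear (F k)"
  shows "pairing F (p + q) = pairing F p + pairing F q"
    and "pairing F (smult c p) = fps_const c * pairing F p"
  by (simp_all add: pairing_def fps_eq_iff functional_add[OF assms] functional_smult[OF assms])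

lemma eval_at_linear:
  assumes F: "\<And>k. functional_linear (F k)" and "weakly_convergent \<epsilon> F" "norm y < \<epsilon>"
  shows "eval_at F y (p + q) = eval_at F y p + eval_at F y q"
    and "eval_at F y (smult c p) = c * eval_at F y p"
proof -
  have r: "ereal (norm y) < fps_conv_radius (pairing F q)" for q
    using assms(2,3) unfolding weakly_convergent_def
    by (meson ereal_less_eq(3) less_ereal.simps(1) less_le_trans)
  show "eval_at F y (p + q) = eval_at F y p + eval_at F y q"
    by (simp add: eval_at_def pairing_linear[OF F] eval_fps_add r)
  show "eval_at F y (smult c p) = c * eval_at F y p"
    by (simp add: eval_at_def pairing_linear[OF F] eval_fps_mult r)
qed

lemma pairing_fps_act_pCons:
  "pairing (fps_act (fps_of_poly (pCons a W)) F) q =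
    pairing F (a * q) + fps_X * pairing (fps_act (fps_of_poly W) F) q"
proof (rule fps_ext)
  fix k
  show "fps_nth (pairing (fps_act (fps_of_poly (pCons a W)) F) q) k =
      fps_nth (pairing F (a * q) + fps_X * pairing (fps_act (fps_of_poly W) F) q) k"
    by (cases k) (simp_all add: pairing_def fps_act_def fmul_def sum.atMost_Suc_shift del: sum.atMost_Suc)
qed

text \<open>A series whose coefficients vanish from some order on, that is, a polynomial \<open>W\<close> in \<open>y\<close> over the
polynomials in \<open>x\<close>, acts through finitely many pairings. It therefore keeps the disc of convergence, and
the action commutes with inserting a number for \<open>y\<close>. In \<open>poly W [:y:]\<close> the number is inserted as a
constant polynomial in \<open>x\<close>.\<close>

lemma fps_act_polynomial:
  assumes F: "\<And>k. functional_linear (F k)" and conv: "weakly_convergent \<epsilon> F"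
  shows "weakly_convergent \<epsilon> (fps_act (fps_of_poly W) F)"
    and "norm y < \<epsilon> \<Longrightarrow> eval_at (fps_act (fps_of_poly W) F) y = poly W [:y:] \<odot> eval_at F y"
proof -
  have r: "ereal \<epsilon> \<le> fps_conv_radius (pairing F q)" for q
    using conv by (simp add: weakly_convergent_def)
  have *: "ereal \<epsilon> \<le> fps_conv_radius (pairing (fps_act (fps_of_poly W) F) q) \<and>
      (norm y < \<epsilon> \<longrightarrow> eval_fps (pairing (fps_act (fps_of_poly W) F) q) y = eval_at F y (poly W [:y:] * q))"
    for q
  proof (induction W)
    case 0
    have "pairing (fps_act 0 F) q = 0"
      by (simp add: pairing_def fps_act_def fmul_def fps_eq_iff functional_0[OF F])
    moreover have "pairing F 0 = 0"
      by (simp add: pairing_def fps_eq_iff functional_0[OF F])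
    ultimately show ?case by (simp add: eval_at_def)
  next
    case (pCons a W)
    let ?A = "pairing (fps_act (fps_of_poly W) F) q"
    have A: "ereal \<epsilon> \<le> fps_conv_radius ?A" using pCons.IH by blast
    have XA: "ereal \<epsilon> \<le> fps_conv_radius (fps_X * ?A)"
      using fps_conv_radius_mult[of fps_X ?A] A by (simp add: order_trans)
    have "ereal \<epsilon> \<le> fps_conv_radius (pairing F (a * q) + fps_X * ?A)"
      using fps_conv_radius_add[of "pairing F (a * q)" "fps_X * ?A"] XA r[of "a * q"]
      by (meson min.boundedI order_trans)
    moreover have "eval_fps (pairing F (a * q) + fps_X * ?A) y = eval_at F y (poly (pCons a W) [:y:] * q)"
      if y: "norm y < \<epsilon>"
    proof -
      have lt: "ereal (norm y) < x" if "ereal \<epsilon> \<le> x" for x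
        using that y by (meson less_ereal.simps(1) less_le_trans)
      have "eval_fps (pairing F (a * q) + fps_X * ?A) y = eval_at F y (a * q) + y * eval_fps ?A y"
        by (simp add: eval_at_def eval_fps_add eval_fps_mult lt[OF r] lt[OF XA] lt[OF A])
      also have "\<dots> = eval_at F y (a * q + smult y (poly W [:y:] * q))"
        using pCons.IH y by (simp add: eval_at_linear[OF F conv y])
      finally show ?thesis by (simp add: algebra_simps)
    qed
    ultimately show ?case by (simp add: pairing_fps_act_pCons)
  qed
  show "weakly_convergent \<epsilon> (fps_act (fps_of_poly W) F)"
    using * by (simp add: weakly_convergent_def)
  show "eval_at (fps_act (fps_of_poly W) F) y = poly W [:y:] \<odot> eval_at F y" if "norm y < \<epsilon>"
    using * that by (simp add: eval_at_def fmul_def fun_eq_iff)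
qed

lemma taylor_shift_polynomial:
  "\<exists>W. fps_of_poly W = taylor_shift \<phi> p \<and> (\<forall>y. poly W [:y:] = taylor_shift_at \<phi> y p)"
proof (induction p)
  case 0
  show ?case by (intro exI[of _ 0]) (simp add: taylor_shift_def taylor_shift_at_def)
next
  case (pCons a p)
  then obtain W where W: "fps_of_poly W = taylor_shift \<phi> p" "\<And>y. poly W [:y:] = taylor_shift_at \<phi> y p"
    by blast
  let ?V = "[:[:a:]:] + [:[:0, 1:], \<phi>:] * W"
  have "fps_of_poly [:[:0, 1:], \<phi>:] = fps_const [:0, 1:] + fps_X * fps_const \<phi>"
    by (simp add: fps_of_poly_pCons mult.commute)
  then have "fps_of_poly ?V = taylor_shift \<phi> (pCons a p)"
    by (simp only: fps_of_poly_add fps_of_poly_mult fps_of_poly_const W taylor_shift_pCons)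
  moreover have "poly ?V [:y:] = taylor_shift_at \<phi> y (pCons a p)" for y
  proof -
    have "poly ?V [:y:] = [:a:] + ([:0, 1:] + smult y \<phi>) * taylor_shift_at \<phi> y p"
      by (simp only: poly_add poly_mult W) simp
    then show ?thesis by (simp add: taylor_shift_at_def pcompose_pCons)
  qed
  ultimately show ?case by blast
qed

text \<open>The exact division by \<open>\<phi>\<close> is carried out on each coefficient of the polynomial in \<open>y\<close>, and can be
cancelled again after inserting a value.\<close>

lemma shift_ratio_polynomial:
  assumes "\<phi> \<noteq> 0"
  shows "\<exists>V. fps_of_poly V = shift_ratio \<phi> \<and> (\<forall>y. poly V [:y:] = shift_ratio_at \<phi> y)"
proof -
  obtain W where W: "fps_of_poly W = taylor_shift \<phi> \<phi>" "\<And>y. poly W [:y:] = taylor_shift_at \<phi> y \<phi>"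
    using taylor_shift_polynomial by blast
  define V where "V = map_poly (\<lambda>c. c div \<phi>) W"
  have V: "fps_of_poly V = shift_ratio \<phi>"
    unfolding V_def shift_ratio_def W(1)[symmetric] by (simp add: fps_eq_iff coeff_map_poly)
  have "fps_of_poly (smult \<phi> V) = fps_of_poly W"
    by (simp add: fps_of_poly_smult V W(1) shift_ratio_exact)
  then have "smult \<phi> V = W" by (simp only: fps_of_poly_eq_iff)
  then have "\<phi> * poly V [:y:] = \<phi> * shift_ratio_at \<phi> y" for y
    using W(2)[of y] by (auto simp: shift_ratio_at_exact)
  then show ?thesis using V assms by auto
qed

lemma shift_ratio_power_taylor_shift_polynomial:
  assumes "\<phi> \<noteq> 0"
  obtains W where "fps_of_poly W = shift_ratio \<phi> ^ k * taylor_shift \<phi> p"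
    "\<And>y. poly W [:y:] = shift_ratio_at \<phi> y ^ k * taylor_shift_at \<phi> y p"
proof -
  obtain V where "fps_of_poly V = shift_ratio \<phi>" "\<And>y. poly V [:y:] = shift_ratio_at \<phi> y"
    using shift_ratio_polynomial[OF assms] by blast
  moreover obtain T where "fps_of_poly T = taylor_shift \<phi> p" "\<And>y. poly T [:y:] = taylor_shift_at \<phi> y p"
    using taylor_shift_polynomial by blast
  ultimately show ?thesis
    by (intro that[of "V ^ k * T"]) (simp_all add: fps_of_poly_mult fps_of_poly_power)
qed

lemma fps_conv_radius_nth_deriv:
  "fps_conv_radius f \<le> fps_conv_radius (fps_nth_deriv m f)" for f :: "complex fps"
proof (induction m)
  case (Suc m)
  then show ?case
    using fps_conv_radius_deriv[of "fps_nth_deriv m f"]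
    by (simp add: fps_nth_deriv_commute order_trans del: fps_nth_deriv.simps)
qed simp

lemma higher_deriv_eval_fps:
  fixes f :: "complex fps"
  assumes "ereal (norm z) < fps_conv_radius f"
  shows "(deriv ^^ m) (eval_fps f) z = eval_fps (fps_nth_deriv m f) z"
  using assms
proof (induction m arbitrary: z)
  case (Suc m)
  have "eventually (\<lambda>w. w \<in> eball 0 (fps_conv_radius f)) (nhds z)"
    using Suc.prems by (intro eventually_nhds_in_open) auto
  then have "eventually (\<lambda>w. (deriv ^^ m) (eval_fps f) w = eval_fps (fps_nth_deriv m f) w) (nhds z)"
    by eventually_elim (auto intro: Suc.IH)
  then have "(deriv ^^ Suc m) (eval_fps f) z = deriv (eval_fps (fps_nth_deriv m f)) z"
    by (simp add: deriv_cong_ev)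
  also have "\<dots> = eval_fps (fps_deriv (fps_nth_deriv m f)) z"
    using less_le_trans[OF Suc.prems fps_conv_radius_nth_deriv] by (simp add: eval_fps_deriv)
  finally show ?case by (simp add: fps_nth_deriv_commute del: fps_nth_deriv.simps)
qed simp

lemma pairing_fps_nth_deriv:
  assumes "functional_linear u"
  shows "pairing (fps_fmul (fps_nth_deriv m A) u) q = fps_nth_deriv m (pairing (fps_fmul A u) q)"
proof (induction m arbitrary: A)
  case (Suc m)
  have "pairing (fps_fmul (fps_deriv A) u) q = fps_deriv (pairing (fps_fmul A u) q)"
    by (rule fps_ext)
      (simp add: pairing_def fps_fmul_def fmul_def of_nat_poly functional_smult[OF assms] del: of_nat_Suc)
  then show ?case by (simp add: Suc.IH)
qed simp

text \<open>If \<open>F = E\<^bold>u\<close> with a series \<open>E\<close>, then the Cauchy product with \<open>F\<close> is multiplication in the ring of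
power series.\<close>

lemma fps_act_mult:
  assumes "functional_linear u" and "\<And>k. F k = fps_nth E k \<odot> u"
  shows "fps_act A F = fps_fmul (A * E) u"
  by (simp add: fun_eq_iff fps_act_def fps_fmul_def assms(2) fmul_fmul fps_mult_nth atLeast0AtMost)
    (simp add: fmul_def sum_distrib_right sum_distrib_left functional_sum[OF assms(1)] mult_ac)

section \<open>Closed form of the generating functional function\<close>

theorem theorem4p1:
  fixes \<phi> \<psi> :: "complex poly"
    and u :: functional
    and P :: "nat \<Rightarrow> complex poly"
    and B r :: "nat \<Rightarrow> complex"
    and C :: "nat \<Rightarrow> nat \<Rightarrow> complex poly"
    and n \<mu> :: nat
  assumes u_linear: "Vector_Spaces.linear smult (*) u"
    and deg_phi: "degree \<phi> \<le> 2"
    and deg_psi: "degree \<psi> \<le> 1"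
    and pearson: "fderiv (\<phi> \<odot> u) = \<psi> \<odot> u"
    and deg_P: "\<And>k. degree (P k) = k"
    and ode: "\<And>k. \<phi> * pderiv (pderiv (P k)) + \<psi> * pderiv (P k) + eigenvalue \<phi> \<psi> k * P k = 0"
    and orthogonal: "\<And>k m. u (P k * P m) = (if k = m then r k else 0)"
    and r_nonzero: "\<And>k. r k \<noteq> 0"
    and rodrigues: "\<And>k. P k \<odot> u = fscale (B k) ((fderiv ^^ k) (shifted_functional \<phi> u k))"
    and B_nonzero: "\<And>k. B k \<noteq> 0"
    and complementary: "complementary_polynomials \<phi> \<psi> u P B C"
  shows
    "fps_fmul (generating_series C n) u = fps_act (shift_ratio \<phi> ^ n) (exp_functional \<phi> u) \<and>
     fps_fmul (fps_nth_deriv \<mu> (generating_series C n)) u =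
       fps_act (shift_ratio_powi \<phi> (int n - int \<mu>) * taylor_shift \<phi> (C \<mu> n)) (exp_functional \<phi> u) \<and>
     (\<exists>\<epsilon>>0.
       weakly_convergent \<epsilon> (exp_functional \<phi> u) \<and>
       weakly_convergent \<epsilon> (fps_fmul (generating_series C n) u) \<and>
       weakly_convergent \<epsilon> (fps_act
         (shift_ratio_powi \<phi> (int n - int \<mu>) * taylor_shift \<phi> (C \<mu> n)) (exp_functional \<phi> u)) \<and>
       (\<forall>y. norm y < \<epsilon> \<longrightarrow>
          eval_at (fps_fmul (generating_series C n) u) y =
            shift_ratio_at \<phi> y ^ n \<odot> eval_at (exp_functional \<phi> u) y \<and>
          (\<lambda>Q. (deriv ^^ \<mu>) (\<lambda>z. eval_at (fps_fmul (generating_series C n) u) z Q) y) =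
            eval_at (fps_act
              (shift_ratio_powi \<phi> (int n - int \<mu>) * taylor_shift \<phi> (C \<mu> n)) (exp_functional \<phi> u)) y \<and>
          (\<mu> \<le> n \<longrightarrow>
            (\<lambda>Q. (deriv ^^ \<mu>) (\<lambda>z. eval_at (fps_fmul (generating_series C n) u) z Q) y) =
            (shift_ratio_at \<phi> y ^ (n - \<mu>) * taylor_shift_at \<phi> y (C \<mu> n)) \<odot>
              eval_at (exp_functional \<phi> u) y)))"
proof -
  note lin = u_linear
  have regular: "p = q" if "p \<odot> u = q \<odot> u" for p q
    using regular_functional[OF lin deg_P orthogonal r_nonzero that] .
  \<comment> \<open>otherwise Rodrigues' formula for \<open>P 1\<close> would make \<open>P 1 \<odot> u\<close> vanish\<close>
  have "\<phi> \<noteq> 0"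
  proof
    assume "\<phi> = 0"
    then have "u (P 1 * P 1) = 0"
      using fun_cong[OF rodrigues[of 1], of "P 1"]
      by (simp add: fmul_def fscale_def fderiv_def functional_0[OF lin])
    then show False using orthogonal[of 1 1] r_nonzero[of 1] by simp
  qed
  have C0: "C 0 m = 1" and C: "raising_recursion \<phi> \<psi> (of_nat m) (\<lambda>\<nu>. C \<nu> m)" for m
    using complementary_raising[OF lin pearson regular \<open>\<phi> \<noteq> 0\<close> B_nonzero rodrigues complementary]
    by blast+
  define F where "F = exp_functional \<phi> u"
  define G where "G = generating_series C n"
  define E where "E = exp_series (\<lambda>\<nu>. C \<nu> 0)"
  define A where "A = shift_ratio_powi \<phi> (int n - int \<mu>) * taylor_shift \<phi> (C \<mu> n)"
  have G: "G = exp_series (\<lambda>\<nu>. C \<nu> n)" by (simp add: G_def generating_series_def exp_series_def)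
  have F: "F k = fps_nth E k \<odot> u" for k
    using exp_functional_raising[OF lin pearson, of "\<lambda>\<nu>. C \<nu> 0"] C[of 0] C0[of 0]
    by (simp add: F_def E_def exp_series_def)
  have F_lin: "functional_linear (F k)" for k
    unfolding F_def by (rule exp_functional_linear[OF lin])
  have closed: "fps_nth_deriv m G =
      shift_ratio_powi \<phi> (int n - int m) * taylor_shift \<phi> (C m n) * E" for m
    unfolding G E_def using raising_closed_form[OF \<open>\<phi> \<noteq> 0\<close> C[of n], of "\<lambda>\<nu>. C \<nu> 0"] C[of 0] C0[of 0]
    by simp
  have T1: "taylor_shift \<phi> 1 = 1" by (simp add: taylor_shift_pCons one_pCons, simp add: taylor_shift_def)
  have G_F: "fps_fmul G u = fps_act (shift_ratio \<phi> ^ n) F"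
    using closed[of 0] by (simp add: fps_act_mult[OF lin F] C0 T1 shift_ratio_powi_def)
  have dG_F: "fps_fmul (fps_nth_deriv \<mu> G) u = fps_act A F"
    by (simp add: fps_act_mult[OF lin F] A_def closed)
  obtain \<epsilon> where "\<epsilon> > 0" and conv_F: "weakly_convergent \<epsilon> F"
    using exp_functional_weakly_convergent[OF lin pearson deg_phi deg_psi] unfolding F_def by blast
  obtain W where W: "fps_of_poly W = shift_ratio \<phi> ^ n * taylor_shift \<phi> 1"
      "\<And>y. poly W [:y:] = shift_ratio_at \<phi> y ^ n * taylor_shift_at \<phi> y 1"
    using shift_ratio_power_taylor_shift_polynomial[OF \<open>\<phi> \<noteq> 0\<close>] by blast
  have W': "fps_of_poly W = shift_ratio \<phi> ^ n" "poly W [:y:] = shift_ratio_at \<phi> y ^ n" for y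
    using W by (simp_all add: T1 taylor_shift_at_def) (simp add: one_pCons pcompose_pCons)
  have conv_G: "weakly_convergent \<epsilon> (fps_fmul G u)"
    unfolding G_F W'(1)[symmetric] by (rule fps_act_polynomial(1)[OF F_lin conv_F])
  have radius: "ereal \<epsilon> \<le> fps_conv_radius (pairing (fps_fmul G u) q)" for q
    using conv_G by (simp add: weakly_convergent_def)
  have pairing_dG: "pairing (fps_act A F) q = fps_nth_deriv \<mu> (pairing (fps_fmul G u) q)" for q
    unfolding dG_F[symmetric] by (rule pairing_fps_nth_deriv[OF lin])
  have conv_dG: "weakly_convergent \<epsilon> (fps_act A F)"
    unfolding weakly_convergent_def pairing_dG
    using order_trans[OF radius fps_conv_radius_nth_deriv] by blast
  have deriv_G: "(\<lambda>q. (deriv ^^ \<mu>) (\<lambda>z. eval_at (fps_fmul G u) z q) y) = eval_at (fps_act A F) y"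
    if "norm y < \<epsilon>" for y
  proof
    fix q
    have "ereal (norm y) < fps_conv_radius (pairing (fps_fmul G u) q)"
      using that radius by (meson less_ereal.simps(1) less_le_trans)
    from higher_deriv_eval_fps[OF this, of \<mu>]
    show "(deriv ^^ \<mu>) (\<lambda>z. eval_at (fps_fmul G u) z q) y = eval_at (fps_act A F) y q"
      by (simp add: eval_at_def pairing_dG)
  qed
  have eval_G: "eval_at (fps_fmul G u) y = shift_ratio_at \<phi> y ^ n \<odot> eval_at F y"
    if "norm y < \<epsilon>" for y
    unfolding G_F W'(1)[symmetric] W'(2)[symmetric]
    by (rule fps_act_polynomial(2)[OF F_lin conv_F that])
  have eval_A: "eval_at (fps_act A F) y =
      (shift_ratio_at \<phi> y ^ (n - \<mu>) * taylor_shift_at \<phi> y (C \<mu> n)) \<odot> eval_at F y"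
    if "norm y < \<epsilon>" "\<mu> \<le> n" for y
  proof -
    obtain V where V: "fps_of_poly V = shift_ratio \<phi> ^ (n - \<mu>) * taylor_shift \<phi> (C \<mu> n)"
        "\<And>y. poly V [:y:] = shift_ratio_at \<phi> y ^ (n - \<mu>) * taylor_shift_at \<phi> y (C \<mu> n)"
      using shift_ratio_power_taylor_shift_polynomial[OF \<open>\<phi> \<noteq> 0\<close>] by blast
    have "A = fps_of_poly V"
      using \<open>\<mu> \<le> n\<close> by (simp add: A_def V shift_ratio_powi_def nat_diff_distrib)
    then show ?thesis
      using fps_act_polynomial(2)[OF F_lin conv_F \<open>norm y < \<epsilon>\<close>, of V] by (simp add: V)
  qed
  show ?thesis
    unfolding F_def[symmetric] G_def[symmetric] A_def[symmetric]
    using G_F dG_F \<open>\<epsilon> > 0\<close> conv_F conv_G conv_dG eval_G deriv_G eval_A by auto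
qed

end
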